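(* Let $q$ be a prime power. Let $H$ be a subgroup of $\mathbb{F}_{q^2}^*$ with index $d\geq 2$. Let $k$ be a nonnegative integer, let $g$ be a generator of the cyclic group $\mathbb{F}_{q^2}^*$, and let $S=\bigcup_{j=0}^k g^j H$. Assume that $S=-S$. Let $X=\operatorname{Cay}(\mathbb{F}_{q^2};S)$. (1) If $d \mid (q+1)$ and $d\geq 6k+2$, then $\omega(X)=q$ and all maximum cliques in $X$ are of the form $a\mathbb{F}_q+b$, where $a\in S$ and $b\in \mathbb{F}_{q^2}$. (2) If $d \nmid (q+1)$, $d\geq 12k+3$, and $q^2-1\geq 2d$, then $\omega(X)\leq q-1$.
   Context: $\mathbb{F}_r$ is the finite field with $r$ elements, $\mathbb{F}_r^*=\mathbb{F}_r\setminus\{0\}$ is its multiplicative group, and $\mathbb{F}_q$ is regarded as the unique subfield of order $q$ of $\mathbb{F}_{q^2}$. Here $-S=\{-s: s\in S\}$ and $a\mathbb{F}_q+b=\{ax+b: x\in\mathbb{F}_q\}$. For an abelian group $G$ and $S\subseteq G\setminus\{0\}$ with $S=-S$, the Cayley graph $\operatorname{Cay}(G;S)$ has vertex set $G$, with two vertices adjacent if and only if their difference lies in $S$; here $G$ is the additive group of $\mathbb{F}_{q^2}$. A clique is a set of pairwise adjacent vertices, a maximum clique is a clique of maximum size, and the clique number $\omega(X)$ is the size of a maximum clique in $X$. *)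

theory Defs
  imports
    "HOL-Algebra.Algebraic_Closure_Type"
    "HOL-Algebra.Multiplicative_Group"
    "HOL-Algebra.Generated_Groups"
    "HOL-Number_Theory.Prime_Powers"
    "HOL-Number_Theory.Residues"
    "HOL-Library.Cardinality"
    "HOL-Library.Ramsey"
begin

abbreviation mult_group :: "'a::field monoid" where
  "mult_group \<equiv> mult_of ring_of_type_algebra"

definition subfield_of_order :: "nat \<Rightarrow> 'a::field set" where
  "subfield_of_order n = (THE K. subfield K ring_of_type_algebra \<and> card K = n)"

text \<open>A graph is a pair of its vertex set and its set of unordered edges. The Cayley graph
  is that of the whole additive group of the type; it is only meaningful for connection
  sets \<open>S = - S\<close> with \<open>0 \<notin> S\<close>, in which case all edges have exactly two elements.\<close>

type_synonym 'a graph = "'a set \<times> 'a set set"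

definition Cay :: "'a::ab_group_add set \<Rightarrow> 'a graph" where
  "Cay S = (UNIV, {{x, y} |x y. x - y \<in> S})"

definition clique_in :: "'a graph \<Rightarrow> 'a set \<Rightarrow> bool" where
  "clique_in \<Gamma> C \<longleftrightarrow> C \<subseteq> fst \<Gamma> \<and> clique C (snd \<Gamma>)"

text \<open>The next two notions are meant for finite graphs only.\<close>

definition max_clique_in :: "'a graph \<Rightarrow> 'a set \<Rightarrow> bool" where
  "max_clique_in \<Gamma> C \<longleftrightarrow> clique_in \<Gamma> C \<and> (\<forall>D. clique_in \<Gamma> D \<longrightarrow> card D \<le> card C)"

definition clique_number :: "'a graph \<Rightarrow> nat" where
  "clique_number \<Gamma> = Max {card C |C. clique_in \<Gamma> C}"

text \<open>The definite description in \<open>subfield_of_order\<close> is well defined for a field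
  of order \<open>q\<^sup>2\<close>; the subfield of order \<open>q\<close> is the fixed field of \<open>x \<mapsto> x ^ q\<close>.\<close>

lemma subfield_power_card:
  fixes K :: "'a::finite_field set"
  assumes K: "subfield K ring_of_type_algebra" and x: "x \<in> K"
  shows "x ^ card K = x"
proof (cases "x = 0")
  case True
  then show ?thesis using x by (auto simp: card_gt_0_iff power_0_left)
next
  case False
  interpret R: field "ring_of_type_algebra :: 'a ring" by (rule field_from_type_algebra)
  have mult: "a * b \<in> K" if "a \<in> K" "b \<in> K" for a b
    using subringE(6)[OF subfieldE(1)[OF K]] that by (simp add: ring_of_type_algebra_def)
  have zero: "0 \<in> K"
    using subringE(2)[OF subfieldE(1)[OF K]] by (simp add: ring_of_type_algebra_def)
  have inj: "inj_on ((*) x) (K - {0})"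
    using False by (auto simp: inj_on_def)
  have sub: "(*) x ` (K - {0}) \<subseteq> K - {0}"
    using False x mult by auto
  have img: "(*) x ` (K - {0}) = K - {0}"
    by (rule card_subset_eq) (use sub inj in \<open>auto simp: card_image\<close>)
  have "(\<Prod>y\<in>K-{0}. x * y) = x ^ (card K - 1) * \<Prod>(K-{0})"
    using zero by (simp add: prod.distrib)
  moreover have "(\<Prod>y\<in>K-{0}. x * y) = \<Prod>((*) x ` (K - {0}))"
    using prod.reindex[OF inj, of id] by (simp add: comp_def)
  moreover have "\<Prod>(K-{0}) \<noteq> 0" by simp
  ultimately have "x ^ (card K - 1) = 1"
    using img by simp
  moreover have "card K > 0" using x by (auto simp: card_gt_0_iff)
  ultimately show ?thesis
    by (metis Suc_pred' mult.right_neutral power_Suc)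
qed

lemma card_power_fixed_le:
  fixes q :: nat
  assumes "q \<ge> 2"
  shows "card {x :: 'a::finite_field. x ^ q + c * x = y} \<le> q"
proof -
  define p where "p = monom 1 q + [:- y, c:]"
  have "degree p = q"
    unfolding p_def using assms by (subst degree_add_eq_left) (auto simp: degree_monom_eq)
  moreover have "poly p x = x ^ q + c * x - y" for x
    by (simp add: p_def poly_monom algebra_simps)
  moreover have "p \<noteq> 0" using \<open>degree p = q\<close> assms by auto
  ultimately show ?thesis
    using card_poly_roots_bound[of p] by simp
qed

lemma subfield_of_order_eq:
  fixes q :: nat
  assumes q: "primepow q" and card: "CARD('a::finite_field) = q\<^sup>2"
  shows "subfield {x :: 'a. x ^ q = x} ring_of_type_algebra"
    and "card {x :: 'a. x ^ q = x} = q"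
    and "\<exists>!K :: 'a set. subfield K ring_of_type_algebra \<and> card K = q"
    and "subfield_of_order q = {x :: 'a. x ^ q = x}"
proof -
  define F where "F = {x :: 'a. x ^ q = x}"
  obtain p n where pn: "prime p" "n > 0" "q = p ^ n"
    using q by (auto simp: primepow_def)
  have q2: "q \<ge> 2" using q primepow_gt_Suc_0[of q] by simp
  have "prime CHAR('a)" by (rule prime_CHAR_semidom) (rule CHAR_pos)
  moreover have "CHAR('a) dvd p ^ (n * 2)"
    using CHAR_dvd_CARD[where ?'a = 'a] card pn by (simp add: power_mult)
  ultimately have "CHAR('a) = p"
    using pn(1) prime_dvd_power primes_dvd_imp_eq by blast
  then have frob: "(x + y) ^ q = x ^ q + y ^ q" for x y :: 'a
    using pn \<open>prime CHAR('a)\<close> by (intro freshmans_dream') auto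
  have fix2: "(x ^ q) ^ q = x" for x :: 'a
    using finite_field_power_card_eq_same[of x] card by (simp add: power_mult power2_eq_square)
  have neg: "(- x) ^ q = - (x ^ q)" for x :: 'a
    using frob[of x "- x"] q2 by (simp add: eq_neg_iff_add_eq_0 add.commute power_0_left)

  interpret R: field "ring_of_type_algebra :: 'a ring" by (rule field_from_type_algebra)
  have sub: "subfield F ring_of_type_algebra"
  proof (rule R.subfieldI')
    have ainv: "\<ominus>\<^bsub>ring_of_type_algebra\<^esub> h = - h" for h :: 'a
      by (rule R.minus_equality) (auto simp: ring_of_type_algebra_def)
    show "subring F ring_of_type_algebra"
      by (rule R.subringI)
        (auto simp: F_def ring_of_type_algebra_def[symmetric] ainv neg,
         auto simp: ring_of_type_algebra_def frob power_mult_distrib)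
    fix k :: 'a
    assume k: "k \<in> F - {\<zero>\<^bsub>ring_of_type_algebra\<^esub>}"
    then have "k \<noteq> 0" by (simp add: ring_of_type_algebra_def)
    then have "inv\<^bsub>ring_of_type_algebra\<^esub> k = inverse k"
      by (intro R.comm_inv_char) (auto simp: ring_of_type_algebra_def)
    then show "inv\<^bsub>ring_of_type_algebra\<^esub> k \<in> F"
      using k by (simp add: F_def power_inverse)
  qed

  have le: "card F \<le> q"
    using card_power_fixed_le[OF q2, of "- 1 :: 'a" 0] by (simp add: F_def)
  have "q * q = card (\<Union>y\<in>F. {x :: 'a. x ^ q + 1 * x = y})"
  proof -
    have "(\<Union>y\<in>F. {x :: 'a. x ^ q + 1 * x = y}) = UNIV"
      by (auto simp: F_def frob fix2 add.commute)
    then show ?thesis using card by (simp add: power2_eq_square)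
  qed
  also have "\<dots> \<le> (\<Sum>y\<in>F. card {x :: 'a. x ^ q + 1 * x = y})"
    by (rule card_UN_le) simp
  also have "\<dots> \<le> (\<Sum>y\<in>F. q)"
    by (intro sum_mono card_power_fixed_le q2)
  finally have "q \<le> card F" using q2 by simp
  with le have cardF: "card F = q" by simp

  have uniq: "K = F" if "subfield K ring_of_type_algebra" "card K = q" for K :: "'a set"
    by (rule card_subset_eq) (use that cardF subfield_power_card[OF that(1)] in \<open>auto simp: F_def\<close>)
  show "subfield {x :: 'a. x ^ q = x} ring_of_type_algebra"
    "card {x :: 'a. x ^ q = x} = q"
    using sub cardF by (auto simp: F_def)
  show "\<exists>!K :: 'a set. subfield K ring_of_type_algebra \<and> card K = q"
    using sub cardF uniq by blast
  show "subfield_of_order q = {x :: 'a. x ^ q = x}"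
    unfolding subfield_of_order_def F_def[symmetric]
    by (rule the_equality) (use sub cardF uniq in blast)+
qed

end

theory Submission
  imports Defs
begin

text \<open>Let \<open>A\<close> be a clique of size \<open>q\<close> containing \<open>0\<close> and \<open>E\<^sub>A(Y) = \<Prod>(1 - a Y)\<close> over \<open>a \<in> A\<close>.
  Since the differences of \<open>A\<close> lie in few cosets of \<open>H\<close>, a Redei polynomial argument shows that
  \<open>E\<^sub>A\<close> has no terms of low positive degree: if \<open>d\<close> divides \<open>q + 1\<close>, one counts the directions
  of \<open>A\<close> in the affine plane over \<open>\<F>\<^sub>q\<close>, otherwise the slopes of \<open>A \<times> A\<close> in the affine plane over
  the whole field. The same applies to \<open>B = {1/a | a \<in> A - {0}} \<union> {0}\<close>, whose differences lie in
  \<open>S S\<inverse> S\<inverse>\<close>. The coefficients of \<open>E\<^sub>B\<close> are, up to a scalar, those of \<open>E\<^sub>A\<close> in reverse order,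
  so only the two extreme coefficients survive. Hence \<open>\<Prod>(X - a) = X ^ q + c X\<close>, and \<open>A\<close> is a
  line \<open>a \<F>\<^sub>q\<close>. If \<open>d\<close> does not divide \<open>q + 1\<close>, no such line minus \<open>0\<close> fits into \<open>S\<close>, because
  the image of \<open>\<F>\<^sub>q\<^sup>*\<close> in the cyclic group of order \<open>d\<close> is a nontrivial subgroup while that of
  \<open>S\<close> is a short interval.\<close>

section \<open>Coefficients of products of linear factors\<close>

text \<open>The coefficient is an elementary symmetric function of degree \<open>m\<close> in affine
  functions of \<open>v\<close>; taking the \<open>v\<close>-term of all \<open>m\<close> factors
  leaves the coefficient for \<beta> alone.\<close>

lemma coeff_prod_linear_polynomial_in_parameter:
  fixes \<alpha> \<beta> :: "'i \<Rightarrow> 'a::comm_ring_1"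
  assumes "finite I"
  shows "\<exists>c. degree c \<le> m \<and> coeff c m = coeff (\<Prod>i\<in>I. [:1, \<beta> i:]) m \<and>
           (\<forall>v. coeff (\<Prod>i\<in>I. [:1, \<alpha> i + v * \<beta> i:]) m = poly c v)"
  using assms
proof (induction I arbitrary: m rule: finite_induct)
  case empty
  show ?case
    by (cases m) (auto intro!: exI[of _ "if m = 0 then 1 else 0"])
next
  case (insert i I)
  show ?case
  proof (cases m)
    case 0
    then show ?thesis
      using insert.IH[of 0] insert.hyps by auto
  next
    case (Suc n)
    obtain c where c: "degree c \<le> n" "coeff c n = coeff (\<Prod>i\<in>I. [:1, \<beta> i:]) n"
      "\<And>v. coeff (\<Prod>i\<in>I. [:1, \<alpha> i + v * \<beta> i:]) n = poly c v"
      using insert.IH[of n] by blast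
    obtain c' where c': "degree c' \<le> m" "coeff c' m = coeff (\<Prod>i\<in>I. [:1, \<beta> i:]) m"
      "\<And>v. coeff (\<Prod>i\<in>I. [:1, \<alpha> i + v * \<beta> i:]) m = poly c' v"
      using insert.IH[of m] by blast
    have "degree (pCons (\<alpha> i) [:\<beta> i:] * c) \<le> 1 + n"
      using c(1) by (intro order.trans[OF degree_mult_le] add_mono) auto
    moreover have "coeff c m = 0"
      using c(1) Suc by (intro coeff_eq_0) auto
    ultimately show ?thesis
      using c c' insert.hyps Suc
      by (intro exI[of _ "c' + [:\<alpha> i, \<beta> i:] * c"])
        (auto intro!: degree_add_le simp: coeff_pCons algebra_simps)
  qed
qed

lemma coeff_prod_linear_eq_0:
  fixes \<alpha> \<beta> :: "'i \<Rightarrow> 'a::idom"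
  assumes "finite I" and "m < card V"
    and zero: "\<And>v. v \<in> V \<Longrightarrow> coeff (\<Prod>i\<in>I. [:1, \<alpha> i + v * \<beta> i:]) m = 0"
  shows "coeff (\<Prod>i\<in>I. [:1, \<beta> i:]) m = 0"
proof -
  obtain c where c: "degree c \<le> m" "coeff c m = coeff (\<Prod>i\<in>I. [:1, \<beta> i:]) m"
    "\<And>v. coeff (\<Prod>i\<in>I. [:1, \<alpha> i + v * \<beta> i:]) m = poly c v"
    using coeff_prod_linear_polynomial_in_parameter[OF assms(1), of m \<beta> \<alpha>] by blast
  have "c = 0"
  proof (rule poly_eqI_degree[of V])
    show "poly c v = poly 0 v" if "v \<in> V" for v
      using zero[OF that] c(3)[of v] by simp
  qed (use c(1) assms(2) in auto)
  with c(2) show ?thesis by simp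
qed

lemma reflect_prod_linear:
  fixes W :: "'a::idom set"
  shows "(\<Prod>w\<in>W. [:1, - w:]) = reflect_poly (\<Prod>w\<in>W. [:- w, 1:])"
  unfolding reflect_poly_prod
  by (intro prod.cong refl) (auto simp: reflect_poly_pCons' monom_altdef)

text \<open>\<open>W\<close> is the full root set of X^n + c X, so the product of the X - w is this
  polynomial, and its reversal is 1 + c Y^(n - 1).\<close>

lemma coeff_prod_roots_eq_0:
  fixes W :: "'a::idom set"
  assumes n: "card W = n" "n \<ge> 2" and root: "\<And>w. w \<in> W \<Longrightarrow> w ^ n + c * w = 0"
    and m: "m \<noteq> 0" "m \<noteq> n - 1"
  shows "coeff (\<Prod>w\<in>W. [:1, - w:]) m = 0"
proof -
  have fin: "finite W" using n by (auto intro: card_ge_0_finite)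
  define P where "P = (\<Prod>w\<in>W. [:- w, 1:])"
  have degP: "degree P = n"
    unfolding P_def using n by (subst degree_prod_sum_eq) auto
  have lead: "coeff P n = 1"
    using lead_coeff_prod[of "\<lambda>w. [:- w, 1:]" W] degP by (simp add: P_def)
  have "P = monom 1 n + [:0, c:]"
  proof (rule poly_eqI_degree_lead_coeff[of _ n _ W])
    show "coeff P n = coeff (monom 1 n + [:0, c:]) n"
      using lead n by (auto simp: coeff_pCons split: nat.split)
    show "degree (monom 1 n + [:0, c:]) \<le> n"
      using n by (intro degree_add_le) (auto simp: degree_monom_eq)
    show "poly P z = poly (monom 1 n + [:0, c:]) z" if "z \<in> W" for z
      using that fin root[OF that]
      by (auto simp: P_def poly_prod poly_monom mult.commute intro!: prod_zero bexI[of _ z])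
  qed (use degP n in auto)
  then show ?thesis
    unfolding reflect_prod_linear P_def[symmetric] coeff_reflect_poly degP
    using m n by (auto simp: coeff_pCons split: nat.split)
qed

text \<open>Redei's lacunarity argument: for each parameter in \<open>V\<close> the specialised product is
  \<open>\<Prod>(1 - w Y)\<close> over the roots of \<open>X ^ n + c X\<close>, so its \<open>m\<close>-th coefficient, a polynomial of
  degree at most \<open>m\<close> in the parameter, has too many zeros.\<close>

lemma coeff_prod_eq_0_if_many_permutations:
  fixes \<alpha> \<beta> :: "'i \<Rightarrow> 'a::idom"
  assumes n: "card I = n" "n \<ge> 2"
    and inj: "\<And>v. v \<in> V \<Longrightarrow> inj_on (\<lambda>i. \<alpha> i + v * \<beta> i) I"
    and root: "\<And>v i. v \<in> V \<Longrightarrow> i \<in> I \<Longrightarrow> (\<alpha> i + v * \<beta> i) ^ n + c v * (\<alpha> i + v * \<beta> i) = 0"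
    and m: "m \<noteq> 0" "m \<noteq> n - 1" "m < card V"
  shows "coeff (\<Prod>i\<in>I. [:1, - \<beta> i:]) m = 0"
proof -
  have fin: "finite I" using n by (auto intro: card_ge_0_finite)
  have "coeff (\<Prod>i\<in>I. [:1, - \<alpha> i + v * - \<beta> i:]) m = 0" if v: "v \<in> V" for v
  proof -
    let ?f = "\<lambda>i. \<alpha> i + v * \<beta> i"
    have "(\<Prod>i\<in>I. [:1, - \<alpha> i + v * - \<beta> i:]) = (\<Prod>w\<in>?f ` I. [:1, - w:])"
      by (subst prod.reindex[OF inj[OF v]]) simp
    also have "coeff \<dots> m = 0"
      by (rule coeff_prod_roots_eq_0[of _ n "c v"])
        (use n m v root inj in \<open>auto simp: card_image\<close>)
    finally show ?thesis .
  qed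
  then show ?thesis
    using coeff_prod_linear_eq_0[OF fin m(3), of "\<lambda>i. - \<alpha> i" "\<lambda>i. - \<beta> i"] by simp
qed

section \<open>Frobenius on coefficients and recognition of a line\<close>

lemma coeff_power_frobenius:
  fixes p :: "'a::idom poly"
  assumes "prime CHAR('a)" and q: "q = CHAR('a) ^ n"
  shows "coeff (p ^ q) (m * q) = coeff p m ^ q"
proof -
  have q0: "q > 0" using assms by (auto simp: prime_gt_0_nat)
  have "p ^ q = (\<Sum>i\<le>degree p. monom (coeff p i) i) ^ q"
    by (simp add: poly_as_sum_of_monoms)
  also have "\<dots> = (\<Sum>i\<le>degree p. monom (coeff p i) i ^ q)"
    by (rule freshmans_dream_sum') (use assms in auto)
  also have "coeff \<dots> (m * q) = (\<Sum>i\<le>degree p. if i = m then coeff p i ^ q else 0)"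
    using q0 by (auto simp: coeff_sum monom_power intro!: sum.cong)
  also have "\<dots> = coeff p m ^ q"
    using q0 by (auto simp: coeff_eq_0 power_0_left)
  finally show ?thesis .
qed

text \<open>The element 0 contributes the factor 1 because \<open>inverse 0 = 0\<close>, and 1 - Y/a
  = (-1/a) (Y - a).\<close>

lemma prod_linear_inverse:
  fixes A :: "'a::field set"
  assumes "finite A" and "0 \<in> A"
  shows "(\<Prod>a\<in>inverse ` A. [:1, - a:]) =
         smult (\<Prod>a\<in>A-{0}. - inverse a) (\<Prod>a\<in>A-{0}. [:- a, 1:])"
proof -
  have "(\<Prod>a\<in>inverse ` A. [:1, - a:]) = (\<Prod>a\<in>A. [:1, - inverse a:])"
    by (subst prod.reindex) (auto simp: inj_on_def)
  also have "\<dots> = (\<Prod>a\<in>A-{0}. [:1, - inverse a:])"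
    using assms by (simp add: prod.remove)
  also have "\<dots> = (\<Prod>a\<in>A-{0}. smult (- inverse a) [:- a, 1:])"
    by (intro prod.cong) auto
  also have "\<dots> = smult (\<Prod>a\<in>A-{0}. - inverse a) (\<Prod>a\<in>A-{0}. [:- a, 1:])"
    by (rule prod_smult)
  finally show ?thesis .
qed

text \<open>Both coefficients in \<open>vanish\<close> are nonzero multiples of coefficient
  \<open>j\<close> of \<open>Q\<close>, so at each \<open>j\<close> either set may supply the zero.
  Then \<open>Q\<close> is X^(q - 1) plus a constant, and all nonzero elements of \<open>A\<close>
  share their (q - 1)-th power.\<close>

lemma eq_dilated_fixed_set:
  fixes A :: "'a::field set" and q :: nat
  assumes zero: "0 \<in> A" and card: "card A = q" "q \<ge> 2"
    and vanish: "\<And>j. 0 < j \<Longrightarrow> j < q - 1 \<Longrightarrow>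
          coeff (\<Prod>a\<in>inverse ` A. [:1, - a:]) j = 0 \<or> coeff (\<Prod>a\<in>A. [:1, - a:]) (q - 1 - j) = 0"
    and fixed: "card {x :: 'a. x ^ q = x} = q"
    and a: "a \<in> A" "a \<noteq> 0"
  shows "A = (\<lambda>x. a * x) ` {x. x ^ q = x}"
proof -
  have fin: "finite A" using card by (auto intro: card_ge_0_finite)
  define Q where "Q = (\<Prod>a\<in>A-{0}. [:- a, 1:])"
  have degQ: "degree Q = q - 1"
    unfolding Q_def using card fin zero by (subst degree_prod_sum_eq) auto
  have lead: "coeff Q (q - 1) = 1"
    using lead_coeff_prod[of "\<lambda>w. [:- w, 1:]" "A - {0}"] degQ by (simp add: Q_def)
  have "(\<Prod>a\<in>A. [:1, - a:]) = (\<Prod>a\<in>A-{0}. [:1, - a:])"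
    using fin zero by (simp add: prod.remove)
  then have reflQ: "(\<Prod>a\<in>A. [:1, - a:]) = reflect_poly Q"
    by (simp add: reflect_prod_linear Q_def)
  have mid: "coeff Q j = 0" if "0 < j" "j < q - 1" for j
  proof -
    have "coeff (reflect_poly Q) (q - 1 - j) = coeff Q j"
      using that unfolding coeff_reflect_poly degQ by simp
    moreover have "coeff (\<Prod>a\<in>inverse ` A. [:1, - a:]) j = 0 \<longleftrightarrow> coeff Q j = 0"
      using fin unfolding prod_linear_inverse[OF fin zero] Q_def[symmetric] by simp
    ultimately show ?thesis
      using vanish[OF that] unfolding reflQ by simp
  qed
  have Q: "Q = monom 1 (q - 1) + [:coeff Q 0:]"
  proof (rule poly_eqI)
    fix j
    consider "j = 0" | "0 < j" "j < q - 1" | "j = q - 1" "j \<noteq> 0" | "j > q - 1" by linarith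
    then show "coeff Q j = coeff (monom 1 (q - 1) + [:coeff Q 0:]) j"
      by cases (use card mid lead degQ in \<open>auto simp: coeff_pCons coeff_eq_0 split: nat.split\<close>)
  qed
  have root: "x ^ (q - 1) = - coeff Q 0" if "x \<in> A" "x \<noteq> 0" for x
  proof -
    have "poly Q x = 0"
      using that fin by (auto simp: Q_def poly_prod)
    then show ?thesis
      by (subst (asm) Q) (simp add: poly_monom eq_neg_iff_add_eq_0)
  qed
  have "x / a \<in> {x. x ^ q = x}" if x: "x \<in> A" for x
  proof (cases "x = 0")
    case False
    then have "(x / a) ^ (q - 1) = 1"
      using root[OF x] root[OF a] a power_not_zero[OF a(2), of "q - 1"] by (simp add: power_divide)
    then have "(x / a) * (x / a) ^ (q - 1) = x / a" by simp
    then show ?thesis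
      using card power_Suc[of "x / a" "q - 1"] by simp
  qed (use card in auto)
  then have sub: "A \<subseteq> (\<lambda>x. a * x) ` {x. x ^ q = x}"
    using a by (auto intro!: image_eqI[of _ _ "_ / a"])
  show ?thesis
  proof (rule card_seteq[OF _ sub])
    have "finite {x :: 'a. x ^ q = x}"
      using fixed card by (auto intro: card_ge_0_finite)
    then show "finite ((\<lambda>x. a * x) ` {x. x ^ q = x})" "card ((\<lambda>x. a * x) ` {x. x ^ q = x}) \<le> card A"
      using card_image_le[of "{x :: 'a. x ^ q = x}" "\<lambda>x. a * x"] card fixed by auto
  qed
qed

section \<open>The field of order q^2: directions and ratios of differences\<close>

lemma order_eq_CHAR_power:
  assumes q: "primepow q" and card: "CARD('a::finite_field) = q\<^sup>2"
  shows "prime CHAR('a)" and "\<exists>n. q = CHAR('a) ^ n"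
proof -
  obtain p n where pn: "prime p" "n > 0" "q = p ^ n"
    using q by (auto simp: primepow_def)
  show prime: "prime CHAR('a)" by (rule prime_CHAR_semidom) (rule CHAR_pos)
  moreover have "CHAR('a) dvd p ^ (n * 2)"
    using CHAR_dvd_CARD[where ?'a = 'a] card pn by (simp add: power_mult)
  ultimately have "CHAR('a) = p"
    using pn(1) prime_dvd_power primes_dvd_imp_eq by blast
  then show "\<exists>n. q = CHAR('a) ^ n" using pn by blast
qed

lemma diff_power_order:
  fixes x y :: "'a::finite_field"
  assumes "primepow q" and "CARD('a) = q\<^sup>2"
  shows "(x - y) ^ q = x ^ q - y ^ q"
proof -
  obtain n where "q = CHAR('a) ^ n" using order_eq_CHAR_power(2)[OF assms] by blast
  then have "(x - y + y) ^ q = (x - y) ^ q + y ^ q"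
    by (intro freshmans_dream'[OF order_eq_CHAR_power(1)[OF assms]])
  then show ?thesis by (simp add: algebra_simps)
qed

lemma power_card_units_eq_1:
  fixes x :: "'a::finite_field"
  assumes "x \<noteq> 0"
  shows "x ^ (CARD('a) - 1) = 1"
proof -
  have "CARD('a) > 0" by simp
  then have "x * x ^ (CARD('a) - 1) = x ^ CARD('a)" by (metis Suc_pred' power_Suc)
  then show ?thesis using assms finite_field_power_card_eq_same[of x] by simp
qed

lemma card_power_eq_le:
  fixes c :: "'a::idom"
  assumes "n > 0"
  shows "finite {x. x ^ n = c}" and "card {x. x ^ n = c} \<le> n"
proof -
  define p where "p = monom 1 n + [:- c:]"
  have deg: "degree p = n"
    unfolding p_def using assms by (subst degree_add_eq_left) (auto simp: degree_monom_eq)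
  moreover have "poly p x = x ^ n - c" for x
    by (simp add: p_def poly_monom)
  moreover have "p \<noteq> 0" using deg assms by auto
  ultimately show "finite {x. x ^ n = c}" "card {x. x ^ n = c} \<le> n"
    using card_poly_roots_bound[of p] poly_roots_finite[of p] by simp_all
qed

text \<open>The linear form \<open>a \<mapsto> v a - a ^ q\<close> over the subfield of order \<open>q\<close> has kernel \<open>x \<cdot> \<F>\<^sub>q\<close>
  when \<open>v = x ^ (q - 1)\<close>, so it is injective on a set that does not determine the direction \<open>x\<close>.\<close>

lemma coeff_prod_eq_0_if_few_directions:
  fixes A T :: "'a::finite_field set"
  assumes q: "primepow q" and card: "CARD('a) = q\<^sup>2" and A: "card A = q"
    and diff: "\<And>x y. x \<in> A \<Longrightarrow> y \<in> A \<Longrightarrow> x \<noteq> y \<Longrightarrow> x - y \<in> T"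
    and closed: "\<And>x y. x \<in> T \<Longrightarrow> y ^ (q - 1) = 1 \<Longrightarrow> x * y \<in> T"
    and m: "m \<noteq> 0" "m \<noteq> q - 1" "m * (q - 1) + card T < q\<^sup>2 - 1"
  shows "coeff (\<Prod>a\<in>A. [:1, - a:]) m = 0"
proof -
  have q2: "q \<ge> 2" using q primepow_gt_Suc_0[of q] by simp
  \<comment> \<open>By closure of \<open>T\<close>, \<open>N\<close> consists of directions that
    \<open>A\<close> misses. At most q - 1 of its elements share a value in \<open>V\<close>, so
    \<open>V\<close> has more than \<open>m\<close> elements.\<close>
  define N where "N = - {0} - T"
  define V where "V = (\<lambda>x. x ^ (q - 1)) ` N"
  have "q\<^sup>2 - 1 = card (- {0} :: 'a set)"
    using card by (simp add: Compl_eq_Diff_UNIV card_Diff_singleton)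
  also have "\<dots> \<le> card (N \<union> T)"
    by (intro card_mono) (auto simp: N_def)
  also have "\<dots> \<le> card N + card T" by (rule card_Un_le)
  finally have N: "q\<^sup>2 - 1 \<le> card N + card T" .
  have "card N = card (\<Union>v\<in>V. {x \<in> N. x ^ (q - 1) = v})"
    by (intro arg_cong[of _ _ card]) (auto simp: V_def)
  also have "\<dots> \<le> (\<Sum>v\<in>V. card {x \<in> N. x ^ (q - 1) = v})"
    by (rule card_UN_le) simp
  also have "\<dots> \<le> (\<Sum>v\<in>V. q - 1)"
  proof (rule sum_mono)
    fix v
    have "card {x \<in> N. x ^ (q - 1) = v} \<le> card {x. x ^ (q - 1) = v}"
      by (intro card_mono) auto
    also have "\<dots> \<le> q - 1" using q2 by (intro card_power_eq_le) auto
    finally show "card {x \<in> N. x ^ (q - 1) = v} \<le> q - 1" .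
  qed
  finally have "card N \<le> card V * (q - 1)" by simp
  then have "m * (q - 1) < card V * (q - 1)"
    using N m(3) by linarith
  then have mV: "m < card V" by simp
  have fix2: "(x ^ q) ^ q = x" for x :: 'a
    using finite_field_power_card_eq_same[of x] card by (simp add: power_mult power2_eq_square)
  have qq: "(q - 1) * (q + 1) = q\<^sup>2 - 1"
    by (simp add: algebra_simps power2_eq_square)
  have power_q: "y * y ^ (q - 1) = y ^ q" for y :: 'a
    using q2 power_Suc[of y "q - 1"] by simp
  show ?thesis
  proof (rule coeff_prod_eq_0_if_many_permutations[of A q V "\<lambda>a. - (a ^ q)" "\<lambda>a. a" "\<lambda>v. v ^ q"])
    fix v assume "v \<in> V"
    then obtain x where x: "x \<noteq> 0" "x \<notin> T" "v = x ^ (q - 1)" by (auto simp: V_def N_def)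
    show "inj_on (\<lambda>a. - (a ^ q) + v * a) A"
    proof (rule inj_onI, rule ccontr)
      fix a b
      assume ab: "a \<in> A" "b \<in> A" "- (a ^ q) + v * a = - (b ^ q) + v * b" "a \<noteq> b"
      have "a ^ q - b ^ q = v * (a - b)"
        using ab(3) by (simp add: algebra_simps)
      then have "(a - b) ^ q = v * (a - b)"
        by (simp only: diff_power_order[OF q card])
      then have "(a - b) ^ (q - 1) = v"
        using power_q[of "a - b"] ab(4) by (simp add: mult.commute)
      then have "(x / (a - b)) ^ (q - 1) = 1"
        using x ab(4) by (simp add: power_divide)
      then have "(a - b) * (x / (a - b)) \<in> T"
        using diff ab by (intro closed) auto
      then show False using x ab(4) by simp
    qed
    fix a
    \<comment> \<open>For w = v a - a^q this relation gives w^q = v^q a^q - a = - v^q w, so the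
      values are roots of X^q + v^q X.\<close>
    have "v ^ (q + 1) = 1"
      using power_card_units_eq_1[OF x(1)] card unfolding x(3) power_mult[symmetric] qq by simp
    then have v: "v * v ^ q = 1" by simp
    have "(- (a ^ q) + v * a) ^ q = v ^ q * a ^ q - a"
      using diff_power_order[OF q card, of "v * a" "a ^ q"] by (simp add: power_mult_distrib fix2)
    also have "\<dots> + v ^ q * (- (a ^ q) + v * a) = (v * v ^ q) * a - a"
      by (simp add: algebra_simps)
    finally show "(- (a ^ q) + v * a) ^ q + v ^ q * (- (a ^ q) + v * a) = 0"
      using v by simp
  qed (use A q2 m mV in auto)
qed

text \<open>A collision of (a, b) and (c, d) gives a - c = u (d - b), and
  \<open>u \<noteq> 0\<close> makes both differences nonzero.\<close>

lemma inj_on_plane_if_ratio_missing: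
  fixes A :: "'a::field set"
  assumes u: "u \<noteq> 0"
    and ratio: "\<And>x y z w. {x, y, z, w} \<subseteq> A \<Longrightarrow> x \<noteq> y \<Longrightarrow> z \<noteq> w \<Longrightarrow> (x - y) / (z - w) \<noteq> u"
  shows "inj_on (\<lambda>i. fst i + u * snd i) (A \<times> A)"
proof (rule inj_onI, rule ccontr)
  fix i j
  assume ij: "i \<in> A \<times> A" "j \<in> A \<times> A" "fst i + u * snd i = fst j + u * snd j" "i \<noteq> j"
  obtain a b where i: "i = (a, b)" by (cases i)
  obtain c d where j: "j = (c, d)" by (cases j)
  have eq: "a - c = u * (d - b)" using ij(3) by (simp add: i j algebra_simps)
  then have "b \<noteq> d" using ij(4) by (auto simp: i j)
  with eq u have "a \<noteq> c" by auto
  then show False using ratio[of a c d b] ij eq \<open>b \<noteq> d\<close> by (simp add: i j)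
qed

text \<open>Here \<open>A \<times> A\<close> is regarded as a subset of the affine plane over the whole field, whose
  slopes are ratios of differences of \<open>A\<close>. The polynomial obtained is the \<open>q\<close>-th power of the
  one for \<open>A\<close>, so Frobenius gives back the coefficients for \<open>A\<close>.\<close>

lemma coeff_prod_eq_0_if_few_ratios:
  fixes A R :: "'a::finite_field set"
  assumes q: "primepow q" and card: "CARD('a) = q\<^sup>2" and A: "card A = q"
    and ratio: "\<And>x y z w. {x, y, z, w} \<subseteq> A \<Longrightarrow> x \<noteq> y \<Longrightarrow> z \<noteq> w \<Longrightarrow> (x - y) / (z - w) \<in> R"
    and m: "m \<noteq> 0" "m * q + card R < q\<^sup>2 - 1"
  shows "coeff (\<Prod>a\<in>A. [:1, - a:]) m = 0"
proof -
  have q2: "q \<ge> 2" using q primepow_gt_Suc_0[of q] by simp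
  define V where "V = - {0} - R"
  have "q\<^sup>2 - 1 = card (- {0} :: 'a set)"
    using card by (simp add: Compl_eq_Diff_UNIV card_Diff_singleton)
  also have "\<dots> \<le> card (V \<union> R)"
    by (intro card_mono) (auto simp: V_def)
  also have "\<dots> \<le> card V + card R" by (rule card_Un_le)
  finally have V: "m * q < card V" using m by simp
  have "coeff (\<Prod>(a, b)\<in>A \<times> A. [:1, - b:]) (m * q) = 0"
    unfolding case_prod_beta
  \<comment> \<open>For a parameter in \<open>V\<close> the q^2 distinct values fill the whole
    field, the root set of X^(q^2) - X; hence the constant -1.\<close>
  proof (rule coeff_prod_eq_0_if_many_permutations[of _ "q\<^sup>2" V fst snd "\<lambda>_. - 1"])
    fix v assume v: "v \<in> V"
    show "inj_on (\<lambda>i. fst i + v * snd i) (A \<times> A)"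
      using v ratio by (intro inj_on_plane_if_ratio_missing) (auto simp: V_def)
    fix i
    show "(fst i + v * snd i) ^ q\<^sup>2 + - 1 * (fst i + v * snd i) = 0"
      using finite_field_power_card_eq_same[of "fst i + v * snd i"] card by simp
  next
    show "card (A \<times> A) = q\<^sup>2" using A by (simp add: power2_eq_square)
    have "2 * 2 \<le> q * q" using q2 by (intro mult_mono) auto
    then show "q\<^sup>2 \<ge> 2" by (simp add: power2_eq_square)
  qed (use m q2 V in auto)
  also have "(\<Prod>(a, b)\<in>A \<times> A. [:1, - b:]) = (\<Prod>a\<in>A. [:1, - a:]) ^ q"
    using A by (simp add: prod.cartesian_product[symmetric])
  finally have "coeff ((\<Prod>a\<in>A. [:1, - a:]) ^ q) (m * q) = 0" .
  then show ?thesis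
    using order_eq_CHAR_power[OF q card] coeff_power_frobenius
    by (metis power_eq_0_iff)
qed

lemma card_le_if_ratio_missing:
  fixes A :: "'a::finite_field set"
  assumes card: "CARD('a) = q\<^sup>2" and u: "u \<noteq> 0"
    and ratio: "\<And>x y z w. {x, y, z, w} \<subseteq> A \<Longrightarrow> x \<noteq> y \<Longrightarrow> z \<noteq> w \<Longrightarrow> (x - y) / (z - w) \<noteq> u"
  shows "card A \<le> q"
proof -
  have "inj_on (\<lambda>i. fst i + u * snd i) (A \<times> A)"
    by (rule inj_on_plane_if_ratio_missing) (fact u, fact ratio)
  then have "card (A \<times> A) \<le> CARD('a)"
    by (metis card_mono card_image finite subset_UNIV)
  then have "(card A)\<^sup>2 \<le> q\<^sup>2" by (simp add: card power2_eq_square)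
  then show ?thesis by (simp add: power2_le_iff_abs_le)
qed

section \<open>Subgroups of the unit group and intervals of cosets\<close>

locale unit_subgroup =
  fixes H :: "'a::finite_field set" and g :: 'a
  assumes one_mem: "1 \<in> H" and zero_notin: "0 \<notin> H"
    and mult_mem: "x \<in> H \<Longrightarrow> y \<in> H \<Longrightarrow> x * y \<in> H"
    and g_nonzero: "g \<noteq> 0"
begin

lemma card_pos: "card H > 0"
  using one_mem by (auto simp: card_gt_0_iff)

lemma power_card_eq_1:
  assumes x: "x \<in> H"
  shows "x ^ card H = 1"
proof -
  have nz: "x \<noteq> 0" using x zero_notin by auto
  then have inj: "inj_on ((*) x) H" by (auto simp: inj_on_def)
  have img: "(*) x ` H = H"
    by (rule card_subset_eq) (use x mult_mem inj in \<open>auto simp: card_image\<close>)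
  have "\<Prod>H = \<Prod>((*) x ` H)" by (simp only: img)
  also have "\<dots> = (\<Prod>y\<in>H. x * y)"
    using prod.reindex[OF inj, of id] by (simp add: comp_def)
  also have "\<dots> = x ^ card H * \<Prod>H" by (simp add: prod.distrib)
  finally show ?thesis using zero_notin by simp
qed

text \<open>\<open>H\<close> consists of roots of X^|H| - 1, which has at most |H| roots. Membership
  becomes an equation, which yields inverses and the subfield units.\<close>

lemma mem_iff_power_card: "x \<in> H \<longleftrightarrow> x ^ card H = 1"
proof -
  have "H = {x. x ^ card H = 1}"
    by (rule card_seteq) (use card_power_eq_le[OF card_pos, of 1] power_card_eq_1 in auto)
  then show ?thesis by blast
qed

lemma inverse_mem: "x \<in> H \<Longrightarrow> inverse x \<in> H"
  by (simp add: mem_iff_power_card power_inverse)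

lemma power_mem: "x \<in> H \<Longrightarrow> x ^ n \<in> H"
  by (induction n) (auto simp: one_mem mult_mem)

text \<open>A run of consecutive cosets. The free factor \<open>c\<close> lets products and inverses
  of runs lie in runs again; the connection set is the run with c = 1 and n = k.\<close>

definition coset_interval :: "'a \<Rightarrow> nat \<Rightarrow> 'a set" where
  "coset_interval c n = (\<Union>j\<le>n. (\<lambda>h. c * g ^ j * h) ` H)"

lemma coset_intervalI: "j \<le> n \<Longrightarrow> h \<in> H \<Longrightarrow> c * g ^ j * h \<in> coset_interval c n"
  by (auto simp: coset_interval_def)

lemma coset_intervalE:
  assumes "x \<in> coset_interval c n"
  obtains j h where "j \<le> n" "h \<in> H" "x = c * g ^ j * h"
  using assms by (auto simp: coset_interval_def)

lemma card_coset_interval_le: "card (coset_interval c n) \<le> (n + 1) * card H"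
proof -
  have "card (coset_interval c n) \<le> (\<Sum>j\<le>n. card ((\<lambda>h. c * g ^ j * h) ` H))"
    unfolding coset_interval_def by (rule card_UN_le) simp
  also have "\<dots> \<le> (\<Sum>j\<le>n. card H)"
    by (intro sum_mono card_image_le) simp
  finally show ?thesis by simp
qed

lemma coset_interval_mult_mem:
  assumes "x \<in> coset_interval c n" and "h \<in> H"
  shows "x * h \<in> coset_interval c n"
proof -
  obtain j h' where "j \<le> n" "h' \<in> H" "x = c * g ^ j * h'"
    using assms by (auto elim!: coset_intervalE)
  then show ?thesis
    using coset_intervalI[of j n "h' * h" c] assms mult_mem by (simp add: mult.assoc)
qed

lemma coset_interval_mult:
  assumes "x \<in> coset_interval c m" and "y \<in> coset_interval d n"
  shows "x * y \<in> coset_interval (c * d) (m + n)"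
proof -
  obtain i h where x: "i \<le> m" "h \<in> H" "x = c * g ^ i * h"
    using assms by (auto elim!: coset_intervalE)
  obtain j h' where y: "j \<le> n" "h' \<in> H" "y = d * g ^ j * h'"
    using assms by (auto elim!: coset_intervalE)
  have "x * y = (c * d) * g ^ (i + j) * (h * h')"
    using x y by (simp add: power_add mult_ac)
  then show ?thesis
    using x y mult_mem by (simp only:) (intro coset_intervalI add_mono)
qed

text \<open>Inversion reverses the run, so the new one starts at the inverse of the former last
  coset.\<close>

lemma coset_interval_inverse:
  assumes "x \<in> coset_interval c n"
  shows "inverse x \<in> coset_interval (inverse (c * g ^ n)) n"
proof -
  obtain j h where x: "j \<le> n" "h \<in> H" "x = c * g ^ j * h"
    using assms by (auto elim!: coset_intervalE)
  have "g ^ n = g ^ j * g ^ (n - j)" using x by (simp flip: power_add)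
  then have "inverse x = inverse (c * g ^ n) * g ^ (n - j) * inverse h"
    using x g_nonzero by (simp add: field_simps)
  then show ?thesis
    using x inverse_mem by (simp only:) (intro coset_intervalI diff_le_self)
qed

lemma coset_interval_divide:
  assumes "x \<in> coset_interval c n" and "y \<in> coset_interval c n"
  shows "x / y \<in> coset_interval (c * inverse (c * g ^ n)) (n + n)"
  using coset_interval_mult[OF assms(1) coset_interval_inverse[OF assms(2)]]
  by (simp add: divide_inverse)

text \<open>Inversion turns differences in \<open>S\<close> into differences in \<open>S S\<inverse> S\<inverse>\<close>, because
  \<open>1/a - 1/b = (b - a) / (a b)\<close>. The element \<open>0\<close> is its own inverse by convention.\<close>

lemma inverse_diff_mem:
  assumes diff: "\<And>x y. x \<in> A \<Longrightarrow> y \<in> A \<Longrightarrow> x \<noteq> y \<Longrightarrow> x - y \<in> coset_interval 1 k"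
    and zero: "0 \<in> A"
    and xy: "x \<in> inverse ` A" "y \<in> inverse ` A" "x \<noteq> y"
  shows "x - y \<in> coset_interval (inverse (g ^ k) * inverse (g ^ k)) (3 * k)"
proof -
  obtain a b where ab: "a \<in> A" "b \<in> A" "a \<noteq> b" "x = inverse a" "y = inverse b"
    using xy by auto
  have triple: "r * inverse s * inverse t \<in> coset_interval (inverse (g ^ k) * inverse (g ^ k)) (3 * k)"
    if "r \<in> coset_interval 1 k" "s \<in> coset_interval 1 k" "t \<in> coset_interval 1 k" for r s t
  proof -
    have "r * inverse s * inverse t \<in>
        coset_interval (1 * inverse (1 * g ^ k) * inverse (1 * g ^ k)) (k + k + k)"
      by (intro coset_interval_mult coset_interval_inverse that)
    then show ?thesis by (simp add: numeral_3_eq_3 add_ac)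
  qed
  consider "a \<noteq> 0" "b \<noteq> 0" | "a = 0" "b \<noteq> 0" | "a \<noteq> 0" "b = 0" using ab by blast
  then show ?thesis
  proof cases
    case 1
    have "x - y = (b - a) * inverse (a - 0) * inverse (b - 0)"
      using 1 ab by (simp add: field_simps)
    then show ?thesis
      by (simp only:) (intro triple diff; use 1 ab zero in auto)
  next
    case 2
    \<comment> \<open>Here x = 0, and the difference -1/b is padded to the shape r/(s t) with r =
      s.\<close>
    have "x - y = (b - 0) * inverse (b - 0) * inverse (0 - b)"
      using 2 ab by (simp add: field_simps)
    then show ?thesis
      by (simp only:) (intro triple diff; use 2 ab zero in auto)
  next
    case 3
    have "x - y = (a - 0) * inverse (a - 0) * inverse (a - 0)"
      using 3 ab by (simp add: field_simps)
    then show ?thesis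
      by (simp only:) (intro triple diff; use 3 ab zero in auto)
  qed
qed

end

section \<open>Extremal sets whose differences lie in few cosets\<close>

locale coset_cayley = unit_subgroup H g for H :: "'a::finite_field set" and g :: 'a +
  fixes q d k :: nat
  assumes primepow_q: "primepow q" and card_field: "CARD('a) = q\<^sup>2"
    and index: "d * card H = q\<^sup>2 - 1"
begin

lemma q_ge_2: "q \<ge> 2"
  using primepow_q primepow_gt_Suc_0[of q] by simp

text \<open>Ratios of differences lie in 2 k + 1 of the d cosets, so some nonzero ratio is
  missing.\<close>

lemma card_diff_set_le:
  assumes diff: "\<And>x y. x \<in> A \<Longrightarrow> y \<in> A \<Longrightarrow> x \<noteq> y \<Longrightarrow> x - y \<in> coset_interval 1 k"
    and d: "d \<ge> 2 * k + 2"
  shows "card A \<le> q"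
proof -
  define R where "R = coset_interval (1 * inverse (1 * g ^ k)) (k + k)"
  have "card R \<le> (2 * k + 1) * card H"
    using card_coset_interval_le[of "1 * inverse (1 * g ^ k)" "k + k"]
    by (simp add: R_def algebra_simps)
  also have "\<dots> < d * card H"
    using d card_pos by (intro mult_strict_right_mono) auto
  also have "\<dots> = card (- {0} :: 'a set)"
    using index card_field by (simp add: Compl_eq_Diff_UNIV card_Diff_singleton)
  finally have "\<not> - {0} \<subseteq> R"
    using card_mono[of R "- {0}"] by auto
  then obtain u where u: "u \<noteq> 0" "u \<notin> R" by auto
  show ?thesis
  proof (rule card_le_if_ratio_missing[OF card_field u(1)])
    fix x y z w assume "{x, y, z, w} \<subseteq> A" "x \<noteq> y" "z \<noteq> w"
    then have "(x - y) / (z - w) \<in> R"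
      unfolding R_def by (intro coset_interval_divide diff) auto
    then show "(x - y) / (z - w) \<noteq> u" using u by auto
  qed
qed

text \<open>If d divides q + 1, then |H| = (q^2 - 1)/d is a multiple of q - 1.\<close>

lemma subfield_units_subset:
  assumes "d dvd q + 1" and "y ^ (q - 1) = 1"
  shows "y \<in> H"
proof -
  obtain e where e: "q + 1 = d * e" using assms by blast
  have "d * card H = (q - 1) * (q + 1)"
    using index by (simp add: algebra_simps power2_eq_square)
  also have "\<dots> = d * ((q - 1) * e)" unfolding e by simp
  finally have "card H = (q - 1) * e" using e by auto
  then show ?thesis
    using assms by (simp add: mem_iff_power_card power_mult)
qed

text \<open>With q + 1 = d e, a coset covers e directions; \<open>A\<close> and its inverses use at
  most (k + 1) e and (3 k + 1) e of the q + 1 directions. Counted by ratios, they use at most 2 k +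
  1 and 6 k + 1 of the d cosets. The sums give the thresholds 4 k + 2 and 8 k + 2.\<close>

lemma extremal_diff_set_eq_line:
  assumes diff: "\<And>x y. x \<in> A \<Longrightarrow> y \<in> A \<Longrightarrow> x \<noteq> y \<Longrightarrow> x - y \<in> coset_interval 1 k"
    and A: "0 \<in> A" "card A = q"
    and d: "d dvd q + 1 \<and> d \<ge> 4 * k + 2 \<or> d \<ge> 8 * k + 2"
    and a: "a \<in> A" "a \<noteq> 0"
  shows "A = (\<lambda>x. a * x) ` {x. x ^ q = x}"
proof (rule eq_dilated_fixed_set)
  fix j assume j: "0 < j" "j < q - 1"
  define c where "c = inverse (g ^ k) * inverse (g ^ k)"
  have diff': "x - y \<in> coset_interval c (3 * k)"
    if "x \<in> inverse ` A" "y \<in> inverse ` A" "x \<noteq> y" for x y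
    unfolding c_def using inverse_diff_mem[OF diff A(1)] that by blast
  have cardB: "card (inverse ` A) = q"
    using A by (subst card_image) (auto simp: inj_on_def)
  let ?E = "\<lambda>A. \<Prod>a\<in>A. [:1, - a:]"
  from d show "coeff (?E (inverse ` A)) j = 0 \<or> coeff (?E A) (q - 1 - j) = 0"
  proof
    assume d: "d dvd q + 1 \<and> d \<ge> 4 * k + 2"
    then obtain e where e: "q + 1 = d * e" by blast
    have qq: "q\<^sup>2 - 1 = (q - 1) * (q + 1)"
      by (simp add: algebra_simps power2_eq_square)
    have "d * card H = d * ((q - 1) * e)" unfolding index qq e by simp
    then have h: "card H = (q - 1) * e" using e by auto
    have vanish: "coeff (?E B) m = 0"
      if B: "card B = q" "\<And>x y. x \<in> B \<Longrightarrow> y \<in> B \<Longrightarrow> x \<noteq> y \<Longrightarrow> x - y \<in> coset_interval b n"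
        and m: "0 < m" "m < q - 1" "m + (n + 1) * e < q + 1" for B m b n
    proof (rule coeff_prod_eq_0_if_few_directions[OF primepow_q card_field B])
      show "x * y \<in> coset_interval b n" if "x \<in> coset_interval b n" "y ^ (q - 1) = 1" for x y
        using that d by (intro coset_interval_mult_mem subfield_units_subset) auto
      have "m * (q - 1) + card (coset_interval b n) \<le> m * (q - 1) + (n + 1) * card H"
        using card_coset_interval_le by simp
      also have "\<dots> = (m + (n + 1) * e) * (q - 1)"
        unfolding h add_mult_distrib by (simp only: mult_ac)
      also have "\<dots> < (q + 1) * (q - 1)"
        using m q_ge_2 by (intro mult_strict_right_mono) auto
      also have "\<dots> = q\<^sup>2 - 1" unfolding qq by (rule mult.commute)
      finally show "m * (q - 1) + card (coset_interval b n) < q\<^sup>2 - 1" .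
    qed (use m in auto)
    have "(4 * k + 2) * e \<le> q + 1" unfolding e using d by (intro mult_right_mono) auto
    then have "(3 * k + 1) * e + (k + 1) * e \<le> q + 1" by (simp add: algebra_simps)
    \<comment> \<open>The indices add to q - 1; if both inequalities failed, their sum would give q
      - 1 + (4 k + 2) e \<ge> 2 (q + 1), contrary to the preceding bound.\<close>
    then have "j + (3 * k + 1) * e < q + 1 \<or> q - 1 - j + (k + 1) * e < q + 1"
      using j by linarith
    then show ?thesis
    proof
      assume "j + (3 * k + 1) * e < q + 1"
      then show ?thesis using vanish[OF cardB diff' j] by blast
    next
      assume "q - 1 - j + (k + 1) * e < q + 1"
      then show ?thesis using vanish[OF A(2) diff, of "q - 1 - j"] j by simp
    qed
  next
    assume d: "d \<ge> 8 * k + 2"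
    have vanish: "coeff (?E B) m = 0"
      if B: "card B = q" "\<And>x y. x \<in> B \<Longrightarrow> y \<in> B \<Longrightarrow> x \<noteq> y \<Longrightarrow> x - y \<in> coset_interval b n"
        and m: "0 < m" "m * q + (2 * n + 1) * card H < q\<^sup>2 - 1" for B m b n
    proof (rule coeff_prod_eq_0_if_few_ratios[OF primepow_q card_field B(1)])
      show "(x - y) / (z - w) \<in> coset_interval (b * inverse (b * g ^ n)) (n + n)"
        if "{x, y, z, w} \<subseteq> B" "x \<noteq> y" "z \<noteq> w" for x y z w
        using that by (intro coset_interval_divide B(2)) auto
      have "card (coset_interval (b * inverse (b * g ^ n)) (n + n)) \<le> (n + n + 1) * card H"
        by (rule card_coset_interval_le)
      also have "n + n + 1 = 2 * n + 1" by simp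
      finally show "m * q + card (coset_interval (b * inverse (b * g ^ n)) (n + n)) < q\<^sup>2 - 1"
        using m by linarith
    qed (use m in auto)
    have "(8 * k + 2) * card H \<le> q\<^sup>2 - 1"
      unfolding index[symmetric] using d by (intro mult_right_mono) auto
    then have le: "(2 * (3 * k) + 1) * card H + (2 * k + 1) * card H \<le> q\<^sup>2 - 1"
      by (simp add: algebra_simps)
    have "j * q + (q - 1 - j) * q = (q - 1) * q"
      using j by (simp flip: add_mult_distrib)
    also have "\<dots> < q\<^sup>2 - 1"
      using q_ge_2 mult_le_mono[of 2 q 2 q]
      by (simp add: diff_mult_distrib power2_eq_square diff_less_mono2)
    finally have "j * q + (2 * (3 * k) + 1) * card H < q\<^sup>2 - 1 \<or>
        (q - 1 - j) * q + (2 * k + 1) * card H < q\<^sup>2 - 1"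
      using le by linarith
    then show ?thesis
    proof
      assume "j * q + (2 * (3 * k) + 1) * card H < q\<^sup>2 - 1"
      then show ?thesis using vanish[OF cardB diff' j(1)] by blast
    next
      assume "(q - 1 - j) * q + (2 * k + 1) * card H < q\<^sup>2 - 1"
      then show ?thesis using vanish[OF A(2) diff, of "q - 1 - j"] j by simp
    qed
  qed
qed (use A a q_ge_2 subfield_of_order_eq(2)[OF primepow_q card_field] in auto)

text \<open>Multiplication by \<open>g ^ t\<close> with \<open>t\<close> or \<open>d - t\<close> congruent to \<open>q + 1\<close> modulo \<open>d\<close> preserves
  \<open>a \<F>\<^sub>q\<^sup>* H\<close>; for \<open>0 < t \<le> d / 2\<close> it moves the largest exponent in \<open>{0..k}\<close> out of this range.\<close>

lemma line_not_in_coset_interval: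
  assumes gen: "\<And>x. x \<noteq> 0 \<Longrightarrow> \<exists>i. x = g ^ i"
    and ndvd: "\<not> d dvd q + 1" and d: "d \<ge> 2 * k + 2" and a: "a \<noteq> 0"
  shows "\<exists>y. y \<noteq> 0 \<and> y ^ q = y \<and> a * y \<notin> coset_interval 1 k"
proof (rule ccontr)
  assume "\<not> ?thesis"
  then have line: "a * y \<in> coset_interval 1 k" if "y \<noteq> 0" "y ^ q = y" for y
    using that by blast
  have qq: "q\<^sup>2 - 1 = (q - 1) * (q + 1)"
    by (simp add: algebra_simps power2_eq_square)
  have order: "q\<^sup>2 - 1 \<le> n" if "g ^ n = 1" "n > 0" for n
  proof -
    have "- {0} \<subseteq> (\<lambda>i. g ^ i) ` {..<n}"
    proof
      fix x :: 'a assume "x \<in> - {0}"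
      then obtain i where "x = g ^ i" using gen by auto
      also have "\<dots> = g ^ (n * (i div n) + i mod n)" by simp
      also have "\<dots> = g ^ (i mod n)" using that unfolding power_add power_mult by simp
      finally show "x \<in> (\<lambda>i. g ^ i) ` {..<n}" using that by auto
    qed
    then have "card (- {0} :: 'a set) \<le> card ((\<lambda>i. g ^ i) ` {..<n})"
      by (intro card_mono) auto
    also have "\<dots> \<le> n" using card_image_le[of "{..<n}" "\<lambda>i. g ^ i"] by simp
    finally show ?thesis
      using card_field by (simp add: Compl_eq_Diff_UNIV card_Diff_singleton)
  qed
  have notin_H: "g ^ i \<notin> H" if "0 < i" "i < d" for i
  proof
    assume "g ^ i \<in> H"
    then have "g ^ (i * card H) = 1" by (simp add: mem_iff_power_card power_mult)
    then have "d * card H \<le> i * card H"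
      using order that card_pos by (simp add: index)
    then show False using that card_pos by simp
  qed
  have g_d: "g ^ d \<in> H"
    using power_card_units_eq_1[OF g_nonzero] card_field
    by (simp add: mem_iff_power_card index flip: power_mult)
  \<comment> \<open>\<open>L\<close> is the group product of the subfield units and
    \<open>H\<close>; the assumption to be refuted puts a L inside the interval.\<close>
  define L where "L = {y * h |y h. y \<noteq> 0 \<and> y ^ q = y \<and> h \<in> H}"
  have L_I: "r * h \<in> L" if "r \<noteq> 0" "r ^ q = r" "h \<in> H" for r h
    using that unfolding L_def by blast
  have L_mult: "x * y \<in> L" if "x \<in> L" "y \<in> L" for x y
  proof -
    obtain r h s h' where *: "x = r * h" "r \<noteq> 0" "r ^ q = r" "h \<in> H"
        "y = s * h'" "s \<noteq> 0" "s ^ q = s" "h' \<in> H"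
      using \<open>x \<in> L\<close> \<open>y \<in> L\<close> unfolding L_def by blast
    have "(r * s) * (h * h') \<in> L"
      using * by (intro L_I mult_mem) (auto simp: power_mult_distrib)
    then show ?thesis using * by (simp add: mult_ac)
  qed
  have L_inverse: "inverse x \<in> L" if "x \<in> L" for x
  proof -
    obtain r h where *: "x = r * h" "r \<noteq> 0" "r ^ q = r" "h \<in> H"
      using \<open>x \<in> L\<close> unfolding L_def by blast
    then have "inverse x = inverse r * inverse h" "(inverse r) ^ q = inverse r" "inverse r \<noteq> 0"
      by (simp_all add: power_inverse)
    then show ?thesis using L_I[of "inverse r" "inverse h"] inverse_mem[OF *(4)] by simp
  qed
  have H_L: "h \<in> L" if "h \<in> H" for h
    using L_I[of 1 h] that by simp
  have aL: "a * x \<in> coset_interval 1 k" if "x \<in> L" for x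
    using that line coset_interval_mult_mem unfolding L_def by (auto simp flip: mult.assoc)
  have g_q1: "g ^ (q + 1) \<in> L"
  proof -
    have "(g ^ (q + 1)) ^ (q - 1) = g ^ (q\<^sup>2 - 1)"
      unfolding qq power_mult[symmetric] by (simp add: mult.commute)
    also have "\<dots> = 1"
      using power_card_units_eq_1[OF g_nonzero] card_field by simp
    finally have "g ^ (q + 1) * (g ^ (q + 1)) ^ (q - 1) = g ^ (q + 1)" by simp
    then have "(g ^ (q + 1)) ^ q = g ^ (q + 1)"
      using q_ge_2 power_Suc[of "g ^ (q + 1)" "q - 1"] by simp
    then show ?thesis
      using L_I[of "g ^ (q + 1)" 1] one_mem g_nonzero by simp
  qed
  define s where "s = (q + 1) mod d"
  have s: "0 < s" "s < d" using ndvd d by (auto simp: s_def mod_greater_zero_iff_not_dvd)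
  have "g ^ (q + 1) = g ^ (d * ((q + 1) div d) + s)" unfolding s_def by simp
  then have "g ^ s = g ^ (q + 1) * inverse ((g ^ d) ^ ((q + 1) div d))"
    using g_nonzero unfolding power_add power_mult by (simp add: field_simps)
  then have gs: "g ^ s \<in> L"
    by (simp only:) (intro L_mult L_inverse g_q1 H_L power_mem g_d)
  have "g ^ (d - s) = g ^ d * inverse (g ^ s)"
    using s g_nonzero by (simp add: power_diff divide_inverse)
  then have gds: "g ^ (d - s) \<in> L"
    by (simp only:) (intro L_mult L_inverse gs H_L g_d)
  obtain t where t: "0 < t" "2 * t \<le> d" "g ^ t \<in> L"
  proof (cases "2 * s \<le> d")
    case True
    then show ?thesis using that s gs by blast
  next
    case False
    then show ?thesis using that[of "d - s"] s gds by auto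
  qed
  \<comment> \<open>These are the exponents below d of the cosets of \<open>H\<close> that make up a
    L.\<close>
  define Z where "Z = {i. i < d \<and> g ^ i * inverse a \<in> L}"
  have Z_iff: "i \<in> Z \<longleftrightarrow> i < d \<and> g ^ i * inverse a \<in> L" for i
    by (simp add: Z_def)
  have small: "i \<le> k" if i: "i \<in> Z" for i
  proof (rule ccontr)
    assume "\<not> i \<le> k"
    have "a * (g ^ i * inverse a) \<in> coset_interval 1 k" using i by (intro aL) (simp add: Z_def)
    moreover have "a * (g ^ i * inverse a) = g ^ i" using a by (simp add: field_simps)
    ultimately have "g ^ i \<in> coset_interval 1 k" by simp
    then obtain j h where j: "j \<le> k" "h \<in> H" "g ^ i = g ^ j * h"
      by (auto elim: coset_intervalE)
    have "g ^ i = g ^ j * g ^ (i - j)" using j \<open>\<not> i \<le> k\<close> by (simp flip: power_add)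
    then have "g ^ (i - j) \<in> H" using j g_nonzero by simp
    moreover have "0 < i - j" "i - j < d" using j \<open>\<not> i \<le> k\<close> i by (auto simp: Z_def)
    ultimately show False using notin_H by blast
  qed
  have "a * 1 \<in> coset_interval 1 k" by (intro aL H_L one_mem)
  then obtain j h where j: "j \<le> k" "h \<in> H" "a = g ^ j * h"
    by (auto elim: coset_intervalE)
  have "g ^ j * inverse a = inverse h" using j a by (simp add: field_simps)
  also have "\<dots> \<in> L" by (intro H_L inverse_mem j)
  finally have "j \<in> Z" using j(1) d by (simp add: Z_def)
  moreover have fin: "finite Z" by (simp add: Z_def)
  ultimately have max: "Max Z \<in> Z" by (intro Max_in) auto
  have "g ^ (Max Z + t) * inverse a = (g ^ Max Z * inverse a) * g ^ t"
    by (simp add: power_add mult_ac)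
  also have "\<dots> \<in> L"
    by (rule L_mult) (use max t(3) in \<open>simp_all add: Z_iff\<close>)
  \<comment> \<open>\<open>Max Z\<close> is at most k < d/2 and t is at most d/2, so the sum stays
    below d.\<close>
  finally have "Max Z + t \<in> Z" using small[OF max] t d by (simp add: Z_iff)
  then show False using Max_ge[OF fin] t by fastforce
qed

end

section \<open>Cliques of the Cayley graph\<close>

text \<open>An unordered edge only records that x - y or y - x lies in \<open>S\<close>; symmetry of
  \<open>S\<close> merges the two cases.\<close>

lemma clique_in_Cay_iff:
  assumes "S = uminus ` S"
  shows "clique_in (Cay S) C \<longleftrightarrow> (\<forall>x\<in>C. \<forall>y\<in>C. x \<noteq> y \<longrightarrow> x - y \<in> S)"
proof -
  have "y - x \<in> S" if "x - y \<in> S" for x y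
    using assms that by (metis image_eqI minus_diff_eq)
  then have "{x, y} \<in> {{x, y} |x y. x - y \<in> S} \<longleftrightarrow> x - y \<in> S" for x y
    by (auto simp: doubleton_eq_iff)
  then show ?thesis by (simp add: clique_in_def Cay_def clique_def)
qed

lemma nat_pow_mult_group: "x [^]\<^bsub>mult_group\<^esub> (n :: nat) = x ^ n"
  by (induction n) (auto simp: nat_pow_def ring_of_type_algebra_def mult.commute)

text \<open>The constant \<open>mult_of\<close> in the definition of \<open>mult_group\<close> is the one of
  \<open>Ring_Divisibility\<close>, whereas the group structure is established for the equal constant of
  \<open>Multiplicative_Group\<close>.\<close>

lemma group_mult_group: "group (mult_group :: 'a::field monoid)"
proof -
  interpret field "ring_of_type_algebra :: 'a ring" by (rule field_from_type_algebra)
  show ?thesis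
    using field_mult_group
    unfolding Ring_Divisibility.mult_of_def Multiplicative_Group.mult_of_def .
qed

theorem theorem1p4:
  fixes q d k :: nat and H S :: "'a::finite_field set" and g :: 'a and \<Gamma> :: "'a graph"
  assumes "primepow q" and "CARD('a) = q\<^sup>2"
    and "subgroup H mult_group" and "card (rcosets\<^bsub>mult_group\<^esub> H) = d" and "d \<ge> 2"
    and "g \<in> carrier mult_group" and "generate mult_group {g} = carrier mult_group"
    and "S = (\<Union>j\<in>{0..k}. (\<lambda>h. g ^ j * h) ` H)"
    and "S = uminus ` S"
    and "\<Gamma> = Cay S"
  shows "(d dvd q + 1 \<and> d \<ge> 6 * k + 2 \<longrightarrow>
           clique_number \<Gamma> = q \<and>
           (\<forall>C. max_clique_in \<Gamma> C \<longrightarrow>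
             (\<exists>a\<in>S. \<exists>b. C = (\<lambda>x. a * x + b) ` subfield_of_order q))) \<and>
         (\<not> d dvd q + 1 \<and> d \<ge> 12 * k + 3 \<and> q\<^sup>2 - 1 \<ge> 2 * d \<longrightarrow>
           clique_number \<Gamma> \<le> q - 1)"
proof -
  interpret G: group "mult_group :: 'a monoid" by (rule group_mult_group)
  have carrier: "carrier (mult_group :: 'a monoid) = - {0}"
    by (auto simp: ring_of_type_algebra_def)
  have mult: "x \<otimes>\<^bsub>mult_group\<^esub> y = x * y" for x y :: 'a
    by (simp add: ring_of_type_algebra_def)
  have one: "\<one>\<^bsub>mult_group\<^esub> = (1 :: 'a)" by (simp add: ring_of_type_algebra_def)
  have "card (rcosets\<^bsub>mult_group\<^esub> H) * card H = card (carrier (mult_group :: 'a monoid))"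
    using G.lagrange[OF assms(3)] by (simp only: Coset.order_def)
  also have "\<dots> = q\<^sup>2 - 1"
    unfolding carrier using assms(2)
    by (simp add: Compl_eq_Diff_UNIV card_Diff_singleton)
  finally have index: "d * card H = q\<^sup>2 - 1" using assms(4) by simp
  interpret coset_cayley H g q d k
  proof
    show "1 \<in> H" using subgroup.one_closed[OF assms(3)] by (simp only: one)
    show "0 \<notin> H" using subgroup.subset[OF assms(3)] unfolding carrier by auto
    show "x * y \<in> H" if "x \<in> H" "y \<in> H" for x y
      using subgroup.m_closed[OF assms(3) that] by (simp only: mult)
    show "g \<noteq> 0" using assms(6) unfolding carrier by auto
  qed (use assms index in auto)
  have S: "S = coset_interval 1 k"
    unfolding assms(8) coset_interval_def by (simp add: atLeast0AtMost)
  have gen: "\<exists>i. x = g ^ i" if "x \<noteq> 0" for x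
  proof -
    have "x \<in> generate mult_group {g}" using that unfolding assms(7) carrier by auto
    also have "generate mult_group {g} = {g [^]\<^bsub>mult_group\<^esub> i | i. i \<in> (UNIV :: nat set)}"
      by (rule G.generate_pow_on_finite_carrier) (use assms(6) in auto)
    finally show ?thesis by (auto simp: nat_pow_mult_group)
  qed
  define K where "K = {x :: 'a. x ^ q = x}"
  have K: "subfield_of_order q = K"
    using subfield_of_order_eq(4)[OF assms(1,2)] by (simp add: K_def)
  have cardK: "card K = q"
    using subfield_of_order_eq(2)[OF assms(1,2)] by (simp add: K_def)
  have clique: "clique_in \<Gamma> C \<longleftrightarrow> (\<forall>x\<in>C. \<forall>y\<in>C. x \<noteq> y \<longrightarrow> x - y \<in> coset_interval 1 k)" for C
    unfolding assms(10) S using clique_in_Cay_iff assms(9) unfolding S by blast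
  have upper: "card C \<le> q" if "clique_in \<Gamma> C" "d \<ge> 2 * k + 2" for C
    using that by (intro card_diff_set_le) (auto simp: clique)
  have line: "\<exists>a\<in>S. \<exists>b. C = (\<lambda>x. a * x + b) ` K"
    if C: "clique_in \<Gamma> C" "card C = q"
      and d: "d dvd q + 1 \<and> d \<ge> 4 * k + 2 \<or> d \<ge> 8 * k + 2" for C
  proof -
    obtain b where b: "b \<in> C" using C q_ge_2 by fastforce
    have "card (C - {b}) > 0" using b C q_ge_2 by simp
    then obtain c where c: "c \<in> C" "c \<noteq> b" by (auto simp: card_gt_0_iff)
    \<comment> \<open>Translation by b puts 0 into the set; a second vertex c supplies the nonzero
      element c - b of \<open>S\<close> as dilation factor.\<close>
    define A where "A = (\<lambda>x. x - b) ` C"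
    have "A = (\<lambda>x. (c - b) * x) ` K"
      unfolding K_def
    proof (rule extremal_diff_set_eq_line[OF _ _ _ d])
      show "card A = q" unfolding A_def using C by (simp add: card_image inj_on_def)
      show "x - y \<in> coset_interval 1 k" if xy: "x \<in> A" "y \<in> A" "x \<noteq> y" for x y
      proof -
        obtain r s where rs: "x = r - b" "y = s - b" "r \<in> C" "s \<in> C"
          using xy by (auto simp: A_def)
        then show ?thesis using xy C(1) unfolding clique by auto
      qed
    qed (use b c in \<open>auto simp: A_def\<close>)
    moreover have "C = (\<lambda>x. x + b) ` A" by (auto simp: A_def image_image)
    ultimately have "C = (\<lambda>x. (c - b) * x + b) ` K" by (simp add: image_image)
    moreover have "c - b \<in> S" using C(1) b c by (auto simp: clique S)
    ultimately show ?thesis by blast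
  qed
  have fin: "finite {card C |C. clique_in \<Gamma> C}"
    by (rule finite_subset[of _ "card ` UNIV"]) auto
  have empty: "clique_in \<Gamma> {}" by (simp add: clique)
  have part1: "clique_number \<Gamma> = q \<and>
      (\<forall>C. max_clique_in \<Gamma> C \<longrightarrow> (\<exists>a\<in>S. \<exists>b. C = (\<lambda>x. a * x + b) ` K))"
    if d: "d dvd q + 1" "d \<ge> 6 * k + 2"
  proof -
    \<comment> \<open>The subfield is itself a clique: its units lie in \<open>H\<close>, the coset
      of exponent 0.\<close>
    have "x - y \<in> coset_interval 1 k" if xy: "x \<in> K" "y \<in> K" "x \<noteq> y" for x y
    proof -
      have "(x - y) * (x - y) ^ (q - 1) = (x - y) ^ q"
        using q_ge_2 power_Suc[of "x - y" "q - 1"] by simp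
      also have "\<dots> = x - y"
        using xy diff_power_order[OF assms(1,2), of x y] by (simp add: K_def)
      finally have "(x - y) ^ (q - 1) = 1" using xy by simp
      then have "x - y \<in> H" using d subfield_units_subset by blast
      then show ?thesis using coset_intervalI[of 0 k "x - y" 1] by simp
    qed
    then have cliqueK: "clique_in \<Gamma> K" by (simp add: clique)
    have "clique_number \<Gamma> = q"
      unfolding clique_number_def
      by (rule Max_eqI[OF fin]) (use upper d cliqueK cardK in auto)
    moreover have "card C = q" if C: "max_clique_in \<Gamma> C" for C
    proof (rule antisym)
      show "card C \<le> q" using C d by (intro upper) (auto simp: max_clique_in_def)
      show "q \<le> card C" using C cliqueK cardK by (auto simp: max_clique_in_def)
    qed
    ultimately show ?thesis
      using line d unfolding max_clique_in_def by auto
  qed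
  have part2: "clique_number \<Gamma> \<le> q - 1" if d: "\<not> d dvd q + 1" "d \<ge> 12 * k + 3"
  proof -
    \<comment> \<open>A clique of size q would be a line whose differences include every a y with y
      a subfield unit, but some a y avoids \<open>S\<close>.\<close>
    have "card C \<le> q - 1" if C: "clique_in \<Gamma> C" for C
    proof (rule ccontr)
      assume "\<not> card C \<le> q - 1"
      then have "card C = q" using upper[OF C] d by simp
      then obtain a b where ab: "a \<in> S" "C = (\<lambda>x. a * x + b) ` K"
        using line[OF C] d by auto
      have "a \<noteq> 0"
        using ab(1) g_nonzero zero_notin by (auto simp: S elim!: coset_intervalE)
      then obtain y where y: "y \<noteq> 0" "y ^ q = y" "a * y \<notin> coset_interval 1 k"
        using line_not_in_coset_interval[of a] gen d by auto
      have "a * y + b \<in> C" "b \<in> C"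
        unfolding ab(2) using y q_ge_2 by (auto simp: K_def intro: image_eqI[of _ _ 0])
      then have "(a * y + b) - b \<in> coset_interval 1 k"
        using C[unfolded clique, rule_format, of "a * y + b" b] y(1) \<open>a \<noteq> 0\<close> by simp
      then show False using y by simp
    qed
    then show ?thesis
      unfolding clique_number_def using fin empty by (subst Max_le_iff) auto
  qed
  show ?thesis using part1 part2 unfolding K by blast
qed

end
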